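(* Let $\Gamma$ be a finite directed graph with graph inverse semigroup $\mathcal{S}(\Gamma)$. (a) Let $L$ be a closed inverse subsemigroup of finite chain type in $\mathcal{S}(\Gamma)$, with minimal element $(w,w)$. Then $L$ has infinite index in $\mathcal{S}(\Gamma)$ if and only if there exist a non-empty directed circuit $c$ in $\Gamma$ and a (possibly empty) directed path $g$ from some vertex $v_0$ of $w$ to a vertex of $c$, with $g$ having no edge in common with $c\cup w$. (b) If $L=(w,w)^{\uparrow}$ and $L$ has finite index in $\mathcal{S}(\Gamma)$, then $$[\mathcal{S}(\Gamma):L]=\sum_{v\in V(w)}N^{\Gamma}_{v,w}.$$ (c) Let $L$ be a closed inverse subsemigroup of infinite chain type in $\mathcal{S}(\Gamma)$. Then $L$ has infinite index in $\mathcal{S}(\Gamma)$.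
   Context: Paths: a path in a directed graph $\Gamma$ is a directed path; a single vertex is allowed as an empty (length zero) path. $\mathbf{d}(v)$ and $\mathbf{r}(v)$ denote the initial and terminal vertices of a path $v$. Paths are composed left to right: $pv$ is $p$ followed by $v$, defined when $\mathbf{r}(p)=\mathbf{d}(v)$. A directed circuit is a path whose initial and terminal vertices coincide. $V(w)$ is the set of vertices of the path $w$. Graph inverse semigroup: $\mathcal{S}(\Gamma)$ has underlying set $\{(v,w): v,w \text{ paths in } \Gamma,\ \mathbf{d}(v)=\mathbf{d}(w)\}\cup\{0\}$, where $0$ is a zero element, with product $$(t,u)(v,w)=\begin{cases}(t,pw) & \text{if } u=pv \text{ for a path } p,\\ (pt,w) & \text{if } v=pu \text{ for a path } p,\\ 0 & \text{otherwise.}\end{cases}$$ It is an inverse semigroup with $(v,w)^{-1}=(w,v)$. Its idempotents are $0$ and the elements $(u,u)$. Order, closure, index: in an inverse semigroup $S$ the natural partial order is $s\leq t$ iff $s=et$ for some idempotent $e$. A subset $A\subseteq S$ is closed if $a\in A$ and $a\leq s$ imply $s\in A$; for $B\subseteq S$, $B^{\uparrow}=\{s\in S: s\geq b \text{ for some } b\in B\}$, and $b^{\uparrow}=\{b\}^{\uparrow}$. An inverse subsemigroup is a non-empty subset closed under products and inverses. For a closed inverse subsemigroup $L$ of $S$, a (right) coset of $L$ is a set $(Lt)^{\uparrow}=\{s\in S: s\geq xt \text{ for some } x\in L\}$ where $t\in S$ satisfies $tt^{-1}\in L$. The index $[S:L]$ is the cardinality of the set of cosets of $L$ in $S$ (the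 cosets need not cover $S$). A proper closed inverse subsemigroup of $\mathcal{S}(\Gamma)$ is of finite (respectively infinite) chain type if it consists of a finite (respectively infinite) chain of idempotents; in (b), $w$ is a path in $\Gamma$ and $(w,w)^{\uparrow}=\{(q,q): w=hq \text{ for some path } h\}$. For a path $w$ in $\Gamma$ and a vertex $v$ of $w$, $N^{\Gamma}_{v,w}$ is the number of distinct directed paths in $\Gamma$ whose initial vertex is $v$ but whose first edge is not in $w$; the empty path $v$ is counted as one such path. *)

theory Defs
  imports "Graph_Theory.Arc_Walk" "HOL-Library.Extended_Nat" "HOL-Algebra.Congruence"
begin

section \<open>Inverse semigroups\<close>

record 's sgrp = "'s partial_object" +
  sprod :: "'s \<Rightarrow> 's \<Rightarrow> 's"  (infixl \<open>\<cdot>\<index>\<close> 70)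

definition is_inverse_of :: "('s, 'm) sgrp_scheme \<Rightarrow> 's \<Rightarrow> 's \<Rightarrow> bool" where
  "is_inverse_of S s t \<longleftrightarrow> t \<in> carrier S \<and> s \<cdot>\<^bsub>S\<^esub> t \<cdot>\<^bsub>S\<^esub> s = s \<and> t \<cdot>\<^bsub>S\<^esub> s \<cdot>\<^bsub>S\<^esub> t = t"

definition inverse_semigroup :: "('s, 'm) sgrp_scheme \<Rightarrow> bool" where
  "inverse_semigroup S \<longleftrightarrow>
     (\<forall>s\<in>carrier S. \<forall>t\<in>carrier S. s \<cdot>\<^bsub>S\<^esub> t \<in> carrier S) \<and>
     (\<forall>s\<in>carrier S. \<forall>t\<in>carrier S. \<forall>u\<in>carrier S.
        s \<cdot>\<^bsub>S\<^esub> t \<cdot>\<^bsub>S\<^esub> u = s \<cdot>\<^bsub>S\<^esub> (t \<cdot>\<^bsub>S\<^esub> u)) \<and>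
     (\<forall>s\<in>carrier S. \<exists>!t. is_inverse_of S s t)"

definition sinv :: "('s, 'm) sgrp_scheme \<Rightarrow> 's \<Rightarrow> 's" where
  "sinv S s = (THE t. is_inverse_of S s t)"

definition idempotents :: "('s, 'm) sgrp_scheme \<Rightarrow> 's set" where
  "idempotents S = {e \<in> carrier S. e \<cdot>\<^bsub>S\<^esub> e = e}"

definition nat_le :: "('s, 'm) sgrp_scheme \<Rightarrow> 's \<Rightarrow> 's \<Rightarrow> bool" where
  "nat_le S s t \<longleftrightarrow> s \<in> carrier S \<and> t \<in> carrier S \<and> (\<exists>e\<in>idempotents S. s = e \<cdot>\<^bsub>S\<^esub> t)"

definition up_closure :: "('s, 'm) sgrp_scheme \<Rightarrow> 's set \<Rightarrow> 's set" where
  "up_closure S B = {s \<in> carrier S. \<exists>b\<in>B. nat_le S b s}"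

definition up_closed :: "('s, 'm) sgrp_scheme \<Rightarrow> 's set \<Rightarrow> bool" where
  "up_closed S A \<longleftrightarrow> A \<subseteq> carrier S \<and> (\<forall>a\<in>A. \<forall>s\<in>carrier S. nat_le S a s \<longrightarrow> s \<in> A)"

definition inverse_subsemigroup :: "('s, 'm) sgrp_scheme \<Rightarrow> 's set \<Rightarrow> bool" where
  "inverse_subsemigroup S A \<longleftrightarrow> A \<noteq> {} \<and> A \<subseteq> carrier S \<and>
     (\<forall>a\<in>A. \<forall>b\<in>A. a \<cdot>\<^bsub>S\<^esub> b \<in> A) \<and> (\<forall>a\<in>A. sinv S a \<in> A)"

definition closed_inverse_subsemigroup :: "('s, 'm) sgrp_scheme \<Rightarrow> 's set \<Rightarrow> bool" where
  "closed_inverse_subsemigroup S L \<longleftrightarrow> inverse_subsemigroup S L \<and> up_closed S L"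

definition idempotent_chain :: "('s, 'm) sgrp_scheme \<Rightarrow> 's set \<Rightarrow> bool" where
  "idempotent_chain S A \<longleftrightarrow> A \<subseteq> idempotents S \<and>
     (\<forall>a\<in>A. \<forall>b\<in>A. nat_le S a b \<or> nat_le S b a)"

definition proper_closed_chain :: "('s, 'm) sgrp_scheme \<Rightarrow> 's set \<Rightarrow> bool" where
  "proper_closed_chain S L \<longleftrightarrow>
     closed_inverse_subsemigroup S L \<and> L \<noteq> carrier S \<and> idempotent_chain S L"

definition finite_chain_type :: "('s, 'm) sgrp_scheme \<Rightarrow> 's set \<Rightarrow> bool" where
  "finite_chain_type S L \<longleftrightarrow> proper_closed_chain S L \<and> finite L"

definition infinite_chain_type :: "('s, 'm) sgrp_scheme \<Rightarrow> 's set \<Rightarrow> bool" where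
  "infinite_chain_type S L \<longleftrightarrow> proper_closed_chain S L \<and> infinite L"

definition minimal_element :: "('s, 'm) sgrp_scheme \<Rightarrow> 's set \<Rightarrow> 's \<Rightarrow> bool" where
  "minimal_element S A m \<longleftrightarrow> m \<in> A \<and> (\<forall>a\<in>A. nat_le S a m \<longrightarrow> a = m)"

definition right_cosets :: "('s, 'm) sgrp_scheme \<Rightarrow> 's set \<Rightarrow> 's set set" where
  "right_cosets S L =
     {up_closure S {x \<cdot>\<^bsub>S\<^esub> t | x. x \<in> L} | t. t \<in> carrier S \<and> t \<cdot>\<^bsub>S\<^esub> sinv S t \<in> L}"

text \<open>All infinite cardinalities are identified with \<open>\<infinity>\<close>, unlike
  \<^const>\<open>card\<close>, which sends them to \<open>0\<close>.\<close>

definition ecard :: "'a set \<Rightarrow> enat" where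
  "ecard A = (if finite A then enat (card A) else \<infinity>)"

definition coset_index :: "('s, 'm) sgrp_scheme \<Rightarrow> 's set \<Rightarrow> enat" where
  "coset_index S L = ecard (right_cosets S L)"

section \<open>Directed paths\<close>

text \<open>Loops, parallel edges and repeated vertices or edges are allowed. The initial
  vertex is stored along with the list of arcs so that the empty paths at different
  vertices are distinct.\<close>

type_synonym ('a, 'b) path = "'a \<times> 'b list"

definition is_path :: "('a, 'b) pre_digraph \<Rightarrow> ('a, 'b) path \<Rightarrow> bool" where
  "is_path G p \<longleftrightarrow> (\<exists>v. pre_digraph.awalk G (fst p) (snd p) v)"

definition dom_path :: "('a, 'b) path \<Rightarrow> 'a" where
  "dom_path p = fst p"

definition ran_path :: "('a, 'b) pre_digraph \<Rightarrow> ('a, 'b) path \<Rightarrow> 'a" where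
  "ran_path G p = last (pre_digraph.awalk_verts G (fst p) (snd p))"

definition path_verts :: "('a, 'b) pre_digraph \<Rightarrow> ('a, 'b) path \<Rightarrow> 'a set" where
  "path_verts G p = set (pre_digraph.awalk_verts G (fst p) (snd p))"

definition path_edges :: "('a, 'b) path \<Rightarrow> 'b set" where
  "path_edges p = set (snd p)"

definition empty_path :: "('a, 'b) path \<Rightarrow> bool" where
  "empty_path p \<longleftrightarrow> snd p = []"

definition circuit :: "('a, 'b) pre_digraph \<Rightarrow> ('a, 'b) path \<Rightarrow> bool" where
  "circuit G c \<longleftrightarrow> is_path G c \<and> dom_path c = ran_path G c"

text \<open>Meaningful only if \<open>p\<close> ends where \<open>v\<close> starts.\<close>

definition path_comp :: "('a, 'b) path \<Rightarrow> ('a, 'b) path \<Rightarrow> ('a, 'b) path" where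
  "path_comp p v = (fst p, snd p @ snd v)"

definition is_left_factor ::
    "('a, 'b) pre_digraph \<Rightarrow> ('a, 'b) path \<Rightarrow> ('a, 'b) path \<Rightarrow> ('a, 'b) path \<Rightarrow> bool" where
  "is_left_factor G u v p \<longleftrightarrow> is_path G p \<and> ran_path G p = dom_path v \<and> u = path_comp p v"

definition diverging_paths :: "('a, 'b) pre_digraph \<Rightarrow> 'a \<Rightarrow> ('a, 'b) path \<Rightarrow> enat" where
  "diverging_paths G v w =
     ecard {p. is_path G p \<and> dom_path p = v \<and> (empty_path p \<or> hd (snd p) \<notin> path_edges w)}"

section \<open>The graph inverse semigroup\<close>

datatype ('a, 'b) gis_elem = GZero | GPair "('a, 'b) path" "('a, 'b) path"

text \<open>The left factor \<open>p\<close> is determined by \<open>u\<close> and \<open>v\<close>, hence the definite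
  descriptions. If both conditions hold then \<open>u = v\<close>, \<open>p\<close> is empty, and the two
  results agree.\<close>

fun gis_prod :: "('a, 'b) pre_digraph \<Rightarrow> ('a, 'b) gis_elem \<Rightarrow> ('a, 'b) gis_elem
    \<Rightarrow> ('a, 'b) gis_elem" where
  "gis_prod G (GPair t u) (GPair v w) =
     (if \<exists>p. is_left_factor G u v p
        then GPair t (path_comp (THE p. is_left_factor G u v p) w)
      else if \<exists>p. is_left_factor G v u p
        then GPair (path_comp (THE p. is_left_factor G v u p) t) w
      else GZero)"
| "gis_prod G GZero y = GZero"
| "gis_prod G x GZero = GZero"

definition gis :: "('a, 'b) pre_digraph \<Rightarrow> ('a, 'b) gis_elem sgrp" where
  "gis G = \<lparr>carrier = insert GZero
       {GPair v w | v w. is_path G v \<and> is_path G w \<and> dom_path v = dom_path w},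
     sprod = gis_prod G\<rparr>"

text \<open>An element acts as the partial injection \<open>pv \<mapsto> pw\<close> on paths; this is a faithful
  representation, from which the inverse semigroup axioms follow.\<close>

definition gis_rel :: "('a, 'b) pre_digraph \<Rightarrow> ('a, 'b) gis_elem
    \<Rightarrow> (('a, 'b) path \<times> ('a, 'b) path) set" where
  "gis_rel G x = (case x of GZero \<Rightarrow> {} | GPair v w \<Rightarrow>
     {(path_comp p v, path_comp p w) | p. is_path G p \<and> ran_path G p = dom_path v})"

lemma left_factor_unique:
  "is_left_factor G u v p \<Longrightarrow> is_left_factor G u v q \<Longrightarrow> p = q"
  unfolding is_left_factor_def path_comp_def by (auto simp: prod_eq_iff)

lemma the_left_factor:
  "is_left_factor G u v p \<Longrightarrow> (THE p. is_left_factor G u v p) = p"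
  by (rule the_equality) (auto intro: left_factor_unique)

context wf_digraph
begin

lemma is_path_iff: "is_path G p \<longleftrightarrow> awalk (fst p) (snd p) (ran_path G p)"
  unfolding is_path_def ran_path_def by (metis awalk_conv)

lemma ran_path_comp:
  "ran_path G p = dom_path v \<Longrightarrow> ran_path G (path_comp p v) = ran_path G v"
  unfolding ran_path_def path_comp_def dom_path_def by (simp add: awlast_append)

lemma dom_path_comp: "dom_path (path_comp p v) = dom_path p"
  unfolding path_comp_def dom_path_def by simp

lemma is_path_comp:
  assumes "ran_path G p = dom_path v"
  shows "is_path G (path_comp p v) \<longleftrightarrow> is_path G p \<and> is_path G v"
  unfolding is_path_iff ran_path_comp[OF assms]
  using assms by (simp add: path_comp_def dom_path_def ran_path_def)

lemma path_comp_assoc: "path_comp p (path_comp q v) = path_comp (path_comp p q) v"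
  unfolding path_comp_def by simp

lemma path_comp_right_cancel: "path_comp p v = path_comp q v \<longleftrightarrow> p = q"
  unfolding path_comp_def by (auto simp: prod_eq_iff)

lemma comparable:
  assumes a: "is_path G a" "ran_path G a = dom_path u"
    and b: "is_path G b" "ran_path G b = dom_path v"
    and eq: "path_comp a u = path_comp b v"
  shows "(\<exists>p. is_left_factor G u v p) \<or> (\<exists>p. is_left_factor G v u p)"
proof -
  have *: "\<exists>p. is_left_factor G v u p"
    if a: "is_path G a" "ran_path G a = dom_path u"
      and b: "is_path G b" "ran_path G b = dom_path v"
      and f: "fst a = fst b" and l: "snd a = snd b @ us" "us @ snd u = snd v" for a b u v us
  proof -
    have a_eq: "a = path_comp b (dom_path v, us)"
      using f l by (simp add: path_comp_def prod_eq_iff)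
    have r: "ran_path G b = dom_path (dom_path v, us)" using b by (simp add: dom_path_def)
    have "is_path G (dom_path v, us)" using a(1) is_path_comp[OF r] a_eq by simp
    moreover have "ran_path G (dom_path v, us) = dom_path u"
      using a(2) ran_path_comp[OF r] a_eq by simp
    moreover have "v = path_comp (dom_path v, us) u"
      using l by (simp add: path_comp_def dom_path_def prod_eq_iff)
    ultimately show ?thesis unfolding is_left_factor_def by blast
  qed
  from eq have f: "fst a = fst b" and "snd a @ snd u = snd b @ snd v"
    by (simp_all add: path_comp_def)
  then obtain us where "snd a = snd b @ us \<and> us @ snd u = snd v
      \<or> snd a @ us = snd b \<and> snd u = us @ snd v"
    by (auto simp: append_eq_append_conv2)
  then show ?thesis
  proof
    assume "snd a = snd b @ us \<and> us @ snd u = snd v"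
    then show ?thesis using *[OF a b f] by blast
  next
    assume "snd a @ us = snd b \<and> snd u = us @ snd v"
    then have "snd b = snd a @ us" "us @ snd v = snd u" by simp_all
    then show ?thesis using *[OF b a f[symmetric]] by blast
  qed
qed

lemma GPair_carrier:
  "GPair v w \<in> carrier (gis G) \<longleftrightarrow> is_path G v \<and> is_path G w \<and> dom_path v = dom_path w"
  unfolding gis_def by (simp del: split_paired_All split_paired_Ex)

lemma GZero_carrier: "GZero \<in> carrier (gis G)"
  unfolding gis_def by simp

lemma gis_carrier_cases:
  assumes "x \<in> carrier (gis G)"
  obtains "x = GZero"
  | v w where "x = GPair v w" "is_path G v" "is_path G w" "dom_path v = dom_path w"
  using assms by (auto simp: gis_def)

lemma gis_prod_left:
  assumes "is_left_factor G u v p"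
  shows "gis_prod G (GPair t u) (GPair v w) = GPair t (path_comp p w)"
  unfolding gis_prod.simps the_left_factor[OF assms] using assms by (metis (full_types))

lemma gis_prod_right:
  assumes "\<nexists>p. is_left_factor G u v p" "is_left_factor G v u p"
  shows "gis_prod G (GPair t u) (GPair v w) = GPair (path_comp p t) w"
  unfolding gis_prod.simps the_left_factor[OF assms(2)] using assms by (metis (full_types))

lemma gis_prod_props:
  assumes x: "x \<in> carrier (gis G)" and y: "y \<in> carrier (gis G)"
  shows "gis_prod G x y \<in> carrier (gis G) \<and>
         gis_rel G (gis_prod G x y) = gis_rel G x O gis_rel G y"
proof -
  consider "x = GZero" | "y = GZero" | t u v w where "x = GPair t u" "y = GPair v w"
    by (metis gis_elem.exhaust)
  then show ?thesis
  proof cases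
    case 1 then show ?thesis by (simp add: gis_def gis_rel_def)
  next
    case 2 then show ?thesis by (cases x) (simp_all add: gis_def gis_rel_def)
  next
    case (3 t u v w)
    then have t: "is_path G t" "is_path G u" "dom_path t = dom_path u"
      and v: "is_path G v" "is_path G w" "dom_path v = dom_path w"
      using x y by (simp_all add: GPair_carrier)
    have O: "gis_rel G x O gis_rel G y =
        {(path_comp a t, path_comp b w) | a b. is_path G a \<and> ran_path G a = dom_path t \<and>
           is_path G b \<and> ran_path G b = dom_path v \<and> path_comp a u = path_comp b v}"
      unfolding 3 gis_rel_def gis_elem.case relcomp_unfold
      by (auto simp del: split_paired_All split_paired_Ex) blast
    consider p where "is_left_factor G u v p"
      | p where "\<nexists>p. is_left_factor G u v p" "is_left_factor G v u p"
      | "\<nexists>p. is_left_factor G u v p" "\<nexists>p. is_left_factor G v u p"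
      by blast
    then show ?thesis
    proof cases
      case (1 p)
      then have p: "is_path G p" "ran_path G p = dom_path v" "u = path_comp p v"
        by (auto simp: is_left_factor_def)
      have dp: "dom_path p = dom_path t" using p t by (simp add: dom_path_comp)
      have xy: "gis_prod G x y = GPair t (path_comp p w)"
        using gis_prod_left[OF 1] 3 by simp
      have c: "gis_prod G x y \<in> carrier (gis G)"
        unfolding xy using t v p(1,2) dp by (simp add: GPair_carrier is_path_comp dom_path_comp)
      have A: "is_path G (path_comp q p) \<and> ran_path G (path_comp q p) = dom_path v"
        if "is_path G q" "ran_path G q = dom_path t" for q
        using that p(1,2) dp t by (simp add: is_path_comp ran_path_comp)
      have "gis_rel G (gis_prod G x y) = gis_rel G x O gis_rel G y"
        unfolding O unfolding xy gis_rel_def gis_elem.case p(3) path_comp_assoc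
          path_comp_right_cancel
        using A by blast
      with c show ?thesis by blast
    next
      case (2 p)
      then have p: "is_path G p" "ran_path G p = dom_path u" "v = path_comp p u"
        by (auto simp: is_left_factor_def)
      have dp: "dom_path p = dom_path v" using p by (simp add: dom_path_comp)
      have xy: "gis_prod G x y = GPair (path_comp p t) w"
        using gis_prod_right[OF 2] 3 by simp
      have c: "gis_prod G x y \<in> carrier (gis G)"
        unfolding xy using t v p(1,2) dp by (simp add: GPair_carrier is_path_comp dom_path_comp)
      have A: "is_path G (path_comp q p) \<and> ran_path G (path_comp q p) = dom_path t"
        if "is_path G q" "ran_path G q = dom_path v" for q
        using that p(1,2) dp t by (simp add: is_path_comp ran_path_comp)
      have "gis_rel G (gis_prod G x y) = gis_rel G x O gis_rel G y"
        unfolding O unfolding xy gis_rel_def gis_elem.case p(3) path_comp_assoc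
          path_comp_right_cancel dom_path_comp
        using A unfolding dp by blast
      with c show ?thesis by blast
    next
      case 3
      then have "gis_rel G x O gis_rel G y = {}"
        unfolding O t(3) using comparable[of _ u _ v] 3 by blast
      moreover have "gis_prod G x y = GZero"
        using 3 \<open>x = GPair t u\<close> \<open>y = GPair v w\<close> by simp
      ultimately show ?thesis by (simp add: gis_rel_def GZero_carrier)
    qed
  qed
qed

lemma gis_rel_inj:
  assumes x: "x \<in> carrier (gis G)" and y: "y \<in> carrier (gis G)"
    and eq: "gis_rel G x = gis_rel G y"
  shows "x = y"
proof -
  have self: "(v, w) \<in> gis_rel G (GPair v w)"
    if "GPair v w \<in> carrier (gis G)" for v w
  proof -
    have "is_path G (dom_path v, [])"
      using that unfolding GPair_carrier by (auto simp: is_path_def awalk_def dom_path_def)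
    moreover have "ran_path G (dom_path v, []) = dom_path v" by (simp add: ran_path_def)
    moreover have "v = path_comp (dom_path v, []) v" "w = path_comp (dom_path v, []) w"
      using that unfolding GPair_carrier by (auto simp: path_comp_def dom_path_def prod_eq_iff)
    ultimately show ?thesis unfolding gis_rel_def by auto
  qed
  show ?thesis
  proof (cases x; cases y)
    fix v w v' w' assume xy: "x = GPair v w" "y = GPair v' w'"
    have "(v, w) \<in> gis_rel G (GPair v' w')" "(v', w') \<in> gis_rel G (GPair v w)"
      using self[of v w] self[of v' w'] x y eq unfolding xy by simp_all
    then obtain p q where p: "v = path_comp p v'" "w = path_comp p w'"
      and r: "ran_path G p = dom_path v'" and q: "v' = path_comp q v" "w' = path_comp q w"
      unfolding gis_rel_def gis_elem.case by blast
    have v: "fst v = fst p" "snd v = snd p @ snd v'" "fst w = fst p" "snd w = snd p @ snd w'"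
      using arg_cong[OF p(1), of fst] arg_cong[OF p(1), of snd]
        arg_cong[OF p(2), of fst] arg_cong[OF p(2), of snd] by (simp_all add: path_comp_def)
    have v': "fst v' = fst q" "snd v' = snd q @ snd v" "fst w' = fst q"
      using arg_cong[OF q(1), of fst] arg_cong[OF q(1), of snd] arg_cong[OF q(2), of fst]
      by (simp_all add: path_comp_def)
    have "length (snd v) = length (snd p) + length (snd v')"
      "length (snd v') = length (snd q) + length (snd v)"
      using arg_cong[OF v(2), of length] arg_cong[OF v'(2), of length] by simp_all
    then have "snd p = []" by simp
    moreover have "fst v = fst v'"
      using r v(1) \<open>snd p = []\<close> by (simp add: ran_path_def dom_path_def)
    ultimately show ?thesis unfolding xy using v v' by (simp add: prod_eq_iff)
  next
    fix v w assume xy: "x = GPair v w" "y = GZero"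
    then have "(v, w) \<in> gis_rel G GZero" using self[of v w] x eq by simp
    then show ?thesis by (simp add: gis_rel_def)
  next
    fix v w assume xy: "x = GZero" "y = GPair v w"
    then have "(v, w) \<in> gis_rel G GZero" using self[of v w] y eq by simp
    then show ?thesis by (simp add: gis_rel_def)
  qed simp
qed

lemma gis_rel_inj_map: "single_valued (gis_rel G x)" "single_valued ((gis_rel G x)\<inverse>)"
proof -
  have "b = b'" if ab: "(a, b) \<in> gis_rel G x" "(a, b') \<in> gis_rel G x" for a b b'
  proof (cases x)
    case (GPair v w)
    then obtain p q where "a = path_comp p v" "b = path_comp p w"
      "a = path_comp q v" "b' = path_comp q w"
      using ab unfolding GPair gis_rel_def gis_elem.case by blast
    then show ?thesis using path_comp_right_cancel[of p _ q] by blast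
  qed (use ab in \<open>simp add: gis_rel_def\<close>)
  moreover have "a = a'" if ab: "(a, b) \<in> gis_rel G x" "(a', b) \<in> gis_rel G x" for a a' b
  proof (cases x)
    case (GPair v w)
    then obtain p q where "b = path_comp p w" "a = path_comp p v"
      "b = path_comp q w" "a' = path_comp q v"
      using ab unfolding GPair gis_rel_def gis_elem.case by blast
    then show ?thesis using path_comp_right_cancel[of p _ q] by blast
  qed (use ab in \<open>simp add: gis_rel_def\<close>)
  ultimately show "single_valued (gis_rel G x)" "single_valued ((gis_rel G x)\<inverse>)"
    unfolding single_valued_def by blast+
qed

lemma gis_inverse:
  assumes v: "is_path G v" "is_path G w" "dom_path v = dom_path w"
  shows "is_inverse_of (gis G) (GPair v w) (GPair w v)"
proof -
  have lf: "is_left_factor G u u (dom_path u, [])" if "is_path G u" for u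
    using that by (auto simp: is_left_factor_def is_path_def awalk_def dom_path_def
        ran_path_def path_comp_def)
  have "gis_prod G (GPair a b) (GPair b c) = GPair a c" 
    if "is_path G b" "dom_path b = dom_path c" for a b c
    using gis_prod_left[OF lf[OF that(1)]] that by (simp add: path_comp_def dom_path_def)
  note pr = this
  have m: "sprod (gis G) = gis_prod G" by (simp add: gis_def)
  have "GPair w v \<in> carrier (gis G)" using v by (simp add: GPair_carrier)
  then show ?thesis unfolding is_inverse_of_def m by (simp only: pr v)
qed

lemma gis_inverse_unique:
  assumes s: "s \<in> carrier (gis G)" and t: "is_inverse_of (gis G) s t"
  shows "gis_rel G t = (gis_rel G s)\<inverse>"
proof -
  have sub: "(gis_rel G s)\<inverse> \<subseteq> gis_rel G t"
    if "gis_rel G s O gis_rel G t O gis_rel G s = gis_rel G s" for s t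
  proof -
    have "(b, a) \<in> gis_rel G t" if ab: "(a, b) \<in> gis_rel G s" for a b
    proof -
      from ab obtain b' a' where "(a, b') \<in> gis_rel G s" "(b', a') \<in> gis_rel G t"
        "(a', b) \<in> gis_rel G s"
        using \<open>gis_rel G s O gis_rel G t O gis_rel G s = gis_rel G s\<close> by blast
      then show ?thesis
        using ab gis_rel_inj_map[of s] unfolding single_valued_def by blast
    qed
    then show ?thesis by auto
  qed
  have tc: "t \<in> carrier (gis G)"
    and e: "gis_prod G (gis_prod G s t) s = s" "gis_prod G (gis_prod G t s) t = t"
    using t by (simp_all add: is_inverse_of_def gis_def)
  have "gis_rel G (gis_prod G (gis_prod G s t) s) = gis_rel G s O gis_rel G t O gis_rel G s"
    "gis_rel G (gis_prod G (gis_prod G t s) t) = gis_rel G t O gis_rel G s O gis_rel G t"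
    using s tc by (simp_all add: gis_prod_props O_assoc)
  then have "(gis_rel G s)\<inverse> \<subseteq> gis_rel G t" "(gis_rel G t)\<inverse> \<subseteq> gis_rel G s"
    using e by (auto intro!: sub)
  then show ?thesis by auto
qed

theorem inverse_semigroup_gis: "inverse_semigroup (gis G)"
  unfolding inverse_semigroup_def
proof (intro conjI ballI)
  have m: "sprod (gis G) = gis_prod G" by (simp add: gis_def)
  fix s t u assume s: "s \<in> carrier (gis G)" and t: "t \<in> carrier (gis G)"
  show "s \<cdot>\<^bsub>gis G\<^esub> t \<in> carrier (gis G)" using gis_prod_props[OF s t] by (simp add: m)
  assume u: "u \<in> carrier (gis G)"
  show "s \<cdot>\<^bsub>gis G\<^esub> t \<cdot>\<^bsub>gis G\<^esub> u = s \<cdot>\<^bsub>gis G\<^esub> (t \<cdot>\<^bsub>gis G\<^esub> u)"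
    unfolding m using s t u
    by (intro gis_rel_inj) (simp_all add: gis_prod_props O_assoc)
next
  fix s assume s: "s \<in> carrier (gis G)"
  have "\<exists>t. is_inverse_of (gis G) s t"
  proof (cases rule: gis_carrier_cases[OF s])
    case 1
    then have "is_inverse_of (gis G) s GZero" by (simp add: is_inverse_of_def gis_def)
    then show ?thesis ..
  next
    case (2 v w)
    then show ?thesis using gis_inverse by blast
  qed
  moreover have "t = t'" if "is_inverse_of (gis G) s t" "is_inverse_of (gis G) s t'" for t t'
    using that gis_inverse_unique[OF s] by (intro gis_rel_inj) (auto simp: is_inverse_of_def)
  ultimately show "\<exists>!t. is_inverse_of (gis G) s t" by blast
qed

theorem sinv_gis:
  assumes "is_path G v" "is_path G w" "dom_path v = dom_path w"
  shows "sinv (gis G) (GPair v w) = GPair w v"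
proof -
  have "GPair v w \<in> carrier (gis G)" using assms by (simp add: GPair_carrier)
  then have "\<exists>!t. is_inverse_of (gis G) (GPair v w) t"
    using inverse_semigroup_gis by (simp add: inverse_semigroup_def)
  then show ?thesis unfolding sinv_def using gis_inverse[OF assms] by (rule the1_equality)
qed

end

end

(* The cosets of the up-closure of (w,w) are the up-closures of the elements (w,x), where x
   starts at d(w), and distinct x give distinct cosets, so the index is the number of paths
   starting at d(w). This is infinite iff a non-empty circuit can be reached from d(w), and then
   a shortest path from w to the circuit avoids the edges of both. Otherwise w has no repeated
   vertex, and each path from d(w) leaves w at a unique vertex, which gives the sum. For an
   infinite chain, the cosets of the elements (q, d(q)) are pairwise distinct because the length
   difference of the two components is invariant under the natural partial order. *)

theory Submission
  imports Defs
begin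

section \<open>Cardinalities with a single infinite value\<close>

lemma ecard_eq_infinity_iff: "ecard A = \<infinity> \<longleftrightarrow> infinite A"
  by (simp add: ecard_def)

lemma ecard_image: "inj_on f A \<Longrightarrow> ecard (f ` A) = ecard A"
  by (simp add: ecard_def card_image finite_image_iff)

lemma ecard_Un_disjoint: "A \<inter> B = {} \<Longrightarrow> ecard (A \<union> B) = ecard A + ecard B"
  by (simp add: ecard_def card_Un_disjoint)

context wf_digraph
begin

section \<open>Directed walks from a vertex\<close>

text \<open>Bare arc lists suffice because the start vertex is fixed. Prefixing an edge is then a
  plain \<open>Cons\<close>.\<close>

definition walks_from :: "'a \<Rightarrow> 'b list set" where
  "walks_from u = {p. \<exists>v. awalk u p v}"

lemma walks_from_split:
  assumes "e \<in> arcs G"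
  shows "walks_from (tail G e) =
    {p \<in> walks_from (tail G e). p = [] \<or> hd p \<noteq> e} \<union> Cons e ` walks_from (head G e)"
proof -
  have "p \<in> Cons e ` walks_from (head G e)"
    if "p \<in> walks_from (tail G e)" "p \<noteq> []" "hd p = e" for p
    using that by (cases p) (force simp: walks_from_def awalk_Cons_iff)+
  moreover have "Cons e ` walks_from (head G e) \<subseteq> walks_from (tail G e)"
    using assms by (auto simp: walks_from_def awalk_Cons_iff)
  ultimately show ?thesis by blast
qed

text \<open>Induction along \<open>es\<close>: a walk from \<open>u\<close> either does not begin
  with the first edge \<open>e\<close>, or is \<open>e\<close> followed by a walk from the head of
  \<open>e\<close>, to which the induction hypothesis applies. Distinctness of the vertices keeps
  the sets of walks for \<open>es\<close> and for \<open>e # es\<close> in step.\<close>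

lemma ecard_walks_from:
  assumes "awalk u es z" "distinct (awalk_verts u es)"
  shows "ecard (walks_from u) =
    (\<Sum>v\<in>set (awalk_verts u es). ecard {p \<in> walks_from v. p = [] \<or> hd p \<notin> set es})"
  using assms
proof (induction es arbitrary: u)
  case Nil
  then show ?case by simp
next
  case (Cons e es)
  let ?V = "set (awalk_verts (head G e) es)"
  let ?D = "\<lambda>v es. {p \<in> walks_from v. p = [] \<or> hd p \<notin> set es}"
  have e: "e \<in> arcs G" "u = tail G e" "awalk (head G e) es z" "u \<notin> ?V"
    using Cons.prems by (auto simp: awalk_Cons_iff)
  have hd: "tail G (hd p) = v" if "p \<in> walks_from v" "p \<noteq> []" for p v
    using that by (cases p) (auto simp: walks_from_def awalk_Cons_iff)
  \<comment> \<open>The walk never returns to \<open>u\<close>, so no edge of \<open>es\<close>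
    leaves \<open>u\<close> and \<open>e\<close> is the only first edge to exclude.\<close>
  have "?D u (e # es) = {p \<in> walks_from u. p = [] \<or> hd p \<noteq> e}"
    using hd e(4) awalk_verts_arc1 by fastforce
  then have "walks_from u = ?D u (e # es) \<union> Cons e ` walks_from (head G e)"
    using walks_from_split[OF e(1)] unfolding e(2) by simp
  then have "ecard (walks_from u) =
      ecard (?D u (e # es) \<union> Cons e ` walks_from (head G e))" by simp
  also have "\<dots> = ecard (?D u (e # es)) + ecard (walks_from (head G e))"
    by (subst ecard_Un_disjoint) (auto simp: ecard_image)
  also have "ecard (walks_from (head G e)) = (\<Sum>v\<in>?V. ecard (?D v es))"
    using Cons.IH[OF e(3)] Cons.prems by simp
  also have "\<dots> = (\<Sum>v\<in>?V. ecard (?D v (e # es)))"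
  proof (intro sum.cong refl arg_cong[of _ _ ecard])
    \<comment> \<open>Since \<open>e\<close> leaves \<open>u\<close>, it cannot be the first edge of
      a walk from a later vertex \<open>v\<close>, and excluding it changes nothing.\<close>
    fix v assume "v \<in> ?V"
    then have "v \<noteq> tail G e" using e by auto
    then show "?D v es = ?D v (e # es)" using hd[of _ v] by auto
  qed
  finally show ?case using e by simp
qed

text \<open>Going round \<open>c\<close> any number of times after \<open>p\<close> gives walks of
  pairwise different lengths.\<close>

lemma infinite_walks_from:
  assumes "awalk u p v" "awalk v c v" "c \<noteq> []"
  shows "infinite (walks_from u)"
proof -
  have c: "awalk v (concat (replicate n c)) v" for n
  proof (induction n)
    case 0
    then show ?case using assms(1) by (auto simp: awalk_Nil_iff)
  next
    case (Suc n)
    then show ?case using assms(2) by (auto intro: awalk_appendI)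
  qed
  have "range (\<lambda>n. p @ concat (replicate n c)) \<subseteq> walks_from u"
    unfolding walks_from_def using awalk_appendI[OF assms(1) c] by blast
  moreover have "inj (\<lambda>n. p @ concat (replicate n c))"
  proof (rule injI)
    fix m n assume "p @ concat (replicate m c) = p @ concat (replicate n c)"
    then have "length (concat (replicate m c)) = length (concat (replicate n c))" by simp
    then show "m = n" using assms(3) by (simp add: length_concat sum_list_replicate)
  qed
  ultimately show ?thesis by (metis finite_imageD finite_subset infinite_UNIV_nat)
qed

text \<open>A repeated vertex would enclose a non-empty closed subwalk, and iterating it would give
  infinitely many walks from \<open>u\<close>.\<close>

lemma distinct_awalk_verts_if_finite_walks:
  assumes "finite (walks_from u)" "awalk u p v"
  shows "distinct (awalk_verts u p)"
  using awalk_not_distinct_decomp[OF assms(2)] infinite_walks_from assms(1) by fastforce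

lemma awalk_rotate:
  assumes "awalk u c u" "c \<noteq> []" "v \<in> set (awalk_verts u c)"
  obtains c' where "awalk v c' v" "c' \<noteq> []"
proof -
  from awalk_decomp[OF assms(1,3)] obtain q r
    where "c = q @ r" "awalk u q v" "awalk v r u" by blast
  then show ?thesis using that[of "r @ q"] assms(2) awalk_appendI by blast
qed

text \<open>The length is minimised over the end points as well as the walk. An edge shared with
  \<open>c\<close> has its tail on \<open>c\<close>, so the walk could stop before it; an edge
  shared with \<open>es\<close> has its head on \<open>es\<close>, so the walk could start after it.
  Either contradicts minimality.\<close>

lemma shortest_awalk_between:
  assumes "awalk x p y" "x \<in> set (awalk_verts u es)" "y \<in> set (awalk_verts v c)"
    and es: "awalk u es z"
  obtains x' p' y' where "awalk x' p' y'" "x' \<in> set (awalk_verts u es)"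
    "y' \<in> set (awalk_verts v c)" "set p' \<inter> (set c \<union> set es) = {}"
proof -
  let ?P = "\<lambda>(x, p, y). awalk x p y \<and> x \<in> set (awalk_verts u es) \<and> y \<in> set (awalk_verts v c)"
  obtain t where t: "?P t" "\<And>t'. ?P t' \<Longrightarrow> length (fst (snd t)) \<le> length (fst (snd t'))"
    using ex_has_least_nat[of ?P "(x, p, y)" "\<lambda>t. length (fst (snd t))"] assms by blast
  obtain x' p' y' where t_eq: "t = (x', p', y')" by (cases t)
  have *: "awalk x' p' y'" "x' \<in> set (awalk_verts u es)" "y' \<in> set (awalk_verts v c)"
    using t(1) t_eq by auto
  have least: "length p' \<le> length q" if "?P (a, q, b)" for a q b
    using t(2)[OF that] t_eq by simp
  have "e \<notin> set c \<union> set es" if e: "e \<in> set p'" for e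
  proof -
    obtain q r where p': "p' = q @ e # r" using e by (meson split_list)
    then have "awalk x' q (tail G e)" "awalk (head G e) r y'"
      using *(1) by (auto simp: awalk_Cons_iff)
    then show ?thesis
      using least[of x' q "tail G e"] least[of "head G e" r y'] * p'
        awalk_verts_arc1[of e c v] awalk_verts_arc2[OF es, of e] by auto
  qed
  then show ?thesis using * that by blast
qed

end

text \<open>Pigeonhole: there are only finitely many walks from \<open>u\<close> without a repeated
  vertex, so some walk has one and contains a closed subwalk.\<close>

lemma (in fin_digraph) infinite_walks_fromE:
  assumes "infinite (walks_from u)"
  obtains p v c where "awalk u p v" "awalk v c v" "c \<noteq> []"
proof -
  have "finite (\<Union>v\<in>verts G. {p. apath u p v})"
    using apaths_finite by (intro finite_UN_I) simp_all
  with assms have "\<not> walks_from u \<subseteq> (\<Union>v\<in>verts G. {p. apath u p v})"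
    using finite_subset by metis
  then obtain p v where "awalk u p v" "\<not> distinct (awalk_verts u p)"
    unfolding walks_from_def apath_def using awalk_last_in_verts by blast
  from awalk_not_distinct_decomp[OF this] show ?thesis using that by fastforce
qed

context wf_digraph
begin

section \<open>Products and the natural partial order\<close>

lemma sprod_gis: "x \<cdot>\<^bsub>gis G\<^esub> y = gis_prod G x y"
  by (simp add: gis_def)

lemma path_comp_eq_right_iff:
  "ran_path G p = dom_path v \<Longrightarrow> path_comp p v = v \<longleftrightarrow> p = (dom_path v, [])"
  by (auto simp: path_comp_def ran_path_def dom_path_def prod_eq_iff)

lemma trivial_path:
  assumes "is_path G v"
  shows "is_path G (dom_path v, [])" "ran_path G (dom_path v, []) = dom_path v"
    "path_comp (dom_path v, []) v = v"
  using assms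
  by (auto simp: is_path_def awalk_def dom_path_def ran_path_def path_comp_def)

lemma gis_prod_comp_left:
  assumes "is_path G p" "ran_path G p = dom_path v"
  shows "gis_prod G (GPair t (path_comp p v)) (GPair v w) = GPair t (path_comp p w)"
  using assms by (intro gis_prod_left) (simp add: is_left_factor_def)

lemma gis_prod_comp_right:
  assumes "is_path G p" "ran_path G p = dom_path u" "is_path G u" "dom_path t = dom_path u"
    "dom_path w = dom_path p"
  shows "gis_prod G (GPair t u) (GPair (path_comp p u) w) = GPair (path_comp p t) w"
proof (cases "\<exists>q. is_left_factor G u (path_comp p u) q")
  \<comment> \<open>The definition of \<open>gis_prod\<close> tests this alternative first. If it
    holds too, comparing lengths in u = q p u makes both prefixes empty, so the two formulas
    agree.\<close>
  case True
  then obtain q where q: "is_left_factor G u (path_comp p u) q" ..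
  then have qp: "ran_path G q = dom_path p" "u = path_comp q (path_comp p u)"
    by (auto simp: is_left_factor_def dom_path_comp)
  have "snd u = snd q @ snd p @ snd u"
    using arg_cong[OF qp(2), of snd] by (simp add: path_comp_def)
  then have "snd q = []" "snd p = []" by simp_all
  then have "path_comp q w = w" "path_comp p t = t"
    using qp(1) assms by (auto simp: path_comp_def ran_path_def dom_path_def prod_eq_iff)
  then show ?thesis using gis_prod_left[OF q, of t w] by simp
next
  case False
  then show ?thesis
    using assms by (intro gis_prod_right) (auto simp: is_left_factor_def)
qed

lemma gis_prod_inverse:
  assumes "is_path G b" "dom_path c = dom_path b"
  shows "gis_prod G (GPair a b) (GPair b c) = GPair a c"
proof -
  have "path_comp (dom_path b, []) c = c"
    using assms by (simp add: path_comp_def dom_path_def prod_eq_iff)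
  then show ?thesis
    using gis_prod_comp_left[OF trivial_path(1,2)[OF assms(1)], of a c] trivial_path(3)[OF assms(1)]
    by simp
qed

text \<open>If (v, w) equals its own square, the square is non-zero, so one component is the other
  with a prefix \<open>p\<close>. Comparing components shows that \<open>p\<close> fixes a path on
  its right, hence is empty.\<close>

lemma idempotents_gis:
  "e \<in> idempotents (gis G) \<longleftrightarrow> e = GZero \<or> (\<exists>u. is_path G u \<and> e = GPair u u)"
proof
  assume e: "e \<in> idempotents (gis G)"
  then have "e \<in> carrier (gis G)" by (simp add: idempotents_def)
  then show "e = GZero \<or> (\<exists>u. is_path G u \<and> e = GPair u u)"
  proof (cases rule: gis_carrier_cases)
    case (2 v w)
    then have ee: "gis_prod G (GPair v w) (GPair v w) = GPair v w"
      using e by (simp add: idempotents_def sprod_gis)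
    then consider p where "is_left_factor G w v p" | p where "is_left_factor G v w p"
      using 2 by (metis gis_elem.distinct(1) gis_prod.simps(1))
    then have "v = w"
    proof cases
      case (1 p)
      then have p: "is_path G p" "ran_path G p = dom_path v" "w = path_comp p v"
        by (auto simp: is_left_factor_def)
      then have "path_comp p w = w" using gis_prod_comp_left[OF p(1,2), of v w] ee by simp
      then show ?thesis using p 2 by (metis path_comp_eq_right_iff)
    next
      case (2 p)
      then have p: "is_path G p" "ran_path G p = dom_path w" "v = path_comp p w"
        by (auto simp: is_left_factor_def)
      have d: "dom_path w = dom_path v" using \<open>dom_path v = dom_path w\<close> by simp
      then have "gis_prod G (GPair v w) (GPair v w) = GPair (path_comp p v) w"
        using gis_prod_comp_right[OF p(1,2) \<open>is_path G w\<close>, of v w] p(3)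
        by (simp add: dom_path_comp)
      then have "path_comp p v = v" using ee by simp
      then show ?thesis using p d by (metis path_comp_eq_right_iff)
    qed
    then show ?thesis using 2 by blast
  qed simp
next
  assume "e = GZero \<or> (\<exists>u. is_path G u \<and> e = GPair u u)"
  then show "e \<in> idempotents (gis G)"
    by (auto simp: idempotents_def sprod_gis GZero_carrier GPair_carrier gis_prod_inverse
        simp del: gis_prod.simps(1))
qed

text \<open>Going down from a pair means putting one common prefix before both components. The
  idempotent witnessing this is (pv, pv).\<close>

lemma nat_le_gis_iff:
  assumes "s \<in> carrier (gis G)" "t \<in> carrier (gis G)"
  shows "nat_le (gis G) s t \<longleftrightarrow> s = GZero \<or> (\<exists>p v w. t = GPair v w \<and> is_path G p \<and>
    ran_path G p = dom_path v \<and> s = GPair (path_comp p v) (path_comp p w))" (is "_ \<longleftrightarrow> ?R")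
proof
  assume "nat_le (gis G) s t"
  then obtain e where e: "e \<in> idempotents (gis G)" "s = gis_prod G e t"
    by (auto simp: nat_le_def sprod_gis)
  show ?R
  proof (cases "s = GZero")
    case False
    then obtain u where u: "is_path G u" "e = GPair u u" using e idempotents_gis by auto
    obtain v w where t: "t = GPair v w" "is_path G v" "is_path G w" "dom_path v = dom_path w"
      using gis_carrier_cases[OF assms(2)] False e(2) u by (metis gis_prod.simps(3))
    consider p where "is_left_factor G u v p" | p where "is_left_factor G v u p"
      using False e(2) u t by (metis gis_prod.simps(1))
    then show ?thesis
    proof cases
      case (1 p)
      then have p: "is_path G p" "ran_path G p = dom_path v" "u = path_comp p v"
        by (auto simp: is_left_factor_def)
      then show ?thesis using e(2) u t gis_prod_comp_left[OF p(1,2), of u w] by metis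
    next
      case (2 p)
      then have p: "is_path G p" "ran_path G p = dom_path u" "v = path_comp p u"
        by (auto simp: is_left_factor_def)
      \<comment> \<open>In this case the idempotent acts as the identity on \<open>t\<close>, so the
        required prefix is the empty path at d(v).\<close>
      have "s = GPair v w"
        using e(2) u t gis_prod_comp_right[OF p(1,2) u(1), of u w] p(3)
        by (simp add: dom_path_comp)
      moreover have "path_comp (dom_path v, []) w = w" using trivial_path(3)[OF t(3)] t(4) by simp
      ultimately show ?thesis using t trivial_path[OF t(2)] by metis
    qed
  qed simp
next
  assume ?R
  then show "nat_le (gis G) s t"
  proof (elim disjE exE conjE)
    assume "s = GZero"
    moreover have "GZero = GZero \<cdot>\<^bsub>gis G\<^esub> t" by (simp add: sprod_gis)
    ultimately show ?thesis using assms idempotents_gis unfolding nat_le_def by blast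
  next
    fix p v w assume *: "t = GPair v w" "is_path G p" "ran_path G p = dom_path v"
      "s = GPair (path_comp p v) (path_comp p w)"
    then have "is_path G (path_comp p v)" using assms by (simp add: GPair_carrier)
    then have "GPair (path_comp p v) (path_comp p v) \<in> idempotents (gis G)"
      using idempotents_gis by blast
    moreover have "s = GPair (path_comp p v) (path_comp p v) \<cdot>\<^bsub>gis G\<^esub> t"
      unfolding sprod_gis * using gis_prod_comp_left[OF *(2,3)] by simp
    ultimately show ?thesis using assms unfolding nat_le_def by blast
  qed
qed

lemma nat_le_gisI:
  assumes "is_path G p" "ran_path G p = dom_path v" "GPair v w \<in> carrier (gis G)"
  shows "nat_le (gis G) (GPair (path_comp p v) (path_comp p w)) (GPair v w)"
proof -
  have "GPair (path_comp p v) (path_comp p w) \<in> carrier (gis G)"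
    using assms by (simp add: GPair_carrier is_path_comp dom_path_comp)
  then show ?thesis using assms nat_le_gis_iff by blast
qed

lemma nat_le_gisE:
  assumes "nat_le (gis G) (GPair a b) t"
  obtains p v w where "t = GPair v w" "is_path G p" "ran_path G p = dom_path v"
    "a = path_comp p v" "b = path_comp p w"
proof -
  have "GPair a b \<in> carrier (gis G)" "t \<in> carrier (gis G)"
    using assms by (simp_all add: nat_le_def)
  then show ?thesis using assms that nat_le_gis_iff by (metis gis_elem.distinct(1) gis_elem.inject)
qed

lemma nat_le_gis_refl:
  assumes "t \<in> carrier (gis G)"
  shows "nat_le (gis G) t t"
  using assms
proof (cases rule: gis_carrier_cases)
  case (2 v w)
  with assms show ?thesis
    using nat_le_gisI[OF trivial_path(1,2)[OF 2(2)], of w] 2 trivial_path(3) by metis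
qed (use assms in \<open>simp add: nat_le_gis_iff\<close>)

lemma nat_le_gis_trans:
  assumes "nat_le (gis G) (GPair a b) t" "nat_le (gis G) t u"
  shows "nat_le (gis G) (GPair a b) u"
proof -
  obtain p v w where 1: "t = GPair v w" "is_path G p" "ran_path G p = dom_path v"
    "a = path_comp p v" "b = path_comp p w" using assms(1) by (rule nat_le_gisE)
  obtain q v' w' where 2: "u = GPair v' w'" "is_path G q" "ran_path G q = dom_path v'"
    "v = path_comp q v'" "w = path_comp q w'" using assms(2) unfolding 1 by (rule nat_le_gisE)
  have "u \<in> carrier (gis G)" using assms(2) by (simp add: nat_le_def)
  moreover have "is_path G (path_comp p q)" "ran_path G (path_comp p q) = dom_path v'"
    using 1 2 by (simp_all add: is_path_comp ran_path_comp dom_path_comp)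
  ultimately show ?thesis using nat_le_gisI 1 2 by (simp add: path_comp_assoc)
qed

text \<open>Reduces a coset to the up-set of one pair as soon as the set of products has a least
  element.\<close>

lemma up_closure_least:
  assumes "m = GPair a b" "m \<in> B" "\<And>y. y \<in> B \<Longrightarrow> nat_le (gis G) m y"
  shows "up_closure (gis G) B = up_closure (gis G) {m}"
  using assms nat_le_gis_trans unfolding up_closure_def by blast

text \<open>The common prefix must fix \<open>w\<close>, hence is empty. This is what makes distinct
  \<open>x\<close> give distinct cosets of (w, x).\<close>

lemma nat_le_gis_same_fst:
  assumes "nat_le (gis G) (GPair w x) (GPair w y)"
  shows "x = y"
proof -
  obtain p where p: "ran_path G p = dom_path w" "w = path_comp p w" "x = path_comp p y"
    using assms by (elim nat_le_gisE) auto
  have "dom_path y = dom_path w" using assms by (auto simp: nat_le_def GPair_carrier)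
  then show ?thesis using p path_comp_eq_right_iff by metis
qed

section \<open>Cosets of a finite chain\<close>

text \<open>The common prefix \<open>k\<close> cancels and the two components share their initial
  vertex, so whatever lies above (w, w) is again diagonal.\<close>

lemma mem_principal_up_closure:
  assumes "is_path G w"
  shows "y \<in> up_closure (gis G) {GPair w w} \<longleftrightarrow> (\<exists>k q. y = GPair q q \<and> is_path G k \<and>
    is_path G q \<and> ran_path G k = dom_path q \<and> w = path_comp k q)"
proof
  assume y: "y \<in> up_closure (gis G) {GPair w w}"
  then have "nat_le (gis G) (GPair w w) y" by (simp add: up_closure_def)
  then obtain k q r where k: "y = GPair q r" "is_path G k" "ran_path G k = dom_path q"
    "w = path_comp k q" "w = path_comp k r" by (rule nat_le_gisE)
  have "is_path G q" "dom_path q = dom_path r"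
    using y k by (simp_all add: up_closure_def GPair_carrier)
  then have "q = r" using k(4,5) by (auto simp: path_comp_def dom_path_def prod_eq_iff)
  then show "\<exists>k q. y = GPair q q \<and> is_path G k \<and>
      is_path G q \<and> ran_path G k = dom_path q \<and> w = path_comp k q"
    using k \<open>is_path G q\<close> by blast
next
  assume "\<exists>k q. y = GPair q q \<and> is_path G k \<and>
    is_path G q \<and> ran_path G k = dom_path q \<and> w = path_comp k q"
  then show "y \<in> up_closure (gis G) {GPair w w}"
    using nat_le_gisI by (auto simp: up_closure_def GPair_carrier simp del: split_paired_Ex)
qed

text \<open>Multiplying (a, b) by the least element (w, w) gives (w, hb), and this is the least of
  all the products.\<close>

lemma principal_coset:
  assumes "is_path G h" "ran_path G h = dom_path a" "GPair a b \<in> carrier (gis G)"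
    and w: "w = path_comp h a"
  shows "up_closure (gis G) {x \<cdot>\<^bsub>gis G\<^esub> GPair a b | x. x \<in> up_closure (gis G) {GPair w w}}
    = up_closure (gis G) {GPair w (path_comp h b)}"
proof -
  let ?L = "up_closure (gis G) {GPair w w}"
  have ab: "is_path G a" "is_path G b" "dom_path a = dom_path b"
    using assms(3) by (simp_all add: GPair_carrier)
  have wp: "is_path G w" unfolding w using assms ab by (simp add: is_path_comp)
  then have "GPair w w \<in> ?L"
    using nat_le_gis_refl by (simp add: up_closure_def GPair_carrier)
  moreover have "GPair w (path_comp h b) = GPair w w \<cdot>\<^bsub>gis G\<^esub> GPair a b"
    using gis_prod_comp_left[OF assms(1,2)] by (simp add: w sprod_gis)
  moreover have "nat_le (gis G) (GPair w (path_comp h b)) (y \<cdot>\<^bsub>gis G\<^esub> GPair a b)" if "y \<in> ?L" for y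
  proof -
    from that obtain k q where q: "y = GPair q q" "is_path G k"
      "is_path G q" "ran_path G k = dom_path q" "w = path_comp k q"
      unfolding mem_principal_up_closure[OF wp] by blast
    have "path_comp k q = path_comp h a" using q w by simp
    \<comment> \<open>Both \<open>q\<close> and \<open>a\<close> are suffixes of \<open>w\<close>,
      so one is a suffix of the other. The product is (q, pb) or (a, b), and (w, hb) arises from it
      by the prefix \<open>k\<close> or \<open>h\<close> respectively.\<close>
    from comparable[OF q(2,4) assms(1,2) this]
    consider p where "is_left_factor G q a p" | p where "is_left_factor G a q p" by blast
    then show ?thesis
    proof cases
      case (1 p)
      then have p: "is_path G p" "ran_path G p = dom_path a" "q = path_comp p a"
        by (auto simp: is_left_factor_def)
      have "h = path_comp k p"
        using q(5) w p(3) path_comp_right_cancel by (metis path_comp_assoc)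
      then have "path_comp h b = path_comp k (path_comp p b)" by (simp add: path_comp_assoc)
      moreover have "y \<cdot>\<^bsub>gis G\<^esub> GPair a b = GPair q (path_comp p b)"
        using gis_prod_comp_left[OF p(1,2)] by (simp add: sprod_gis q p)
      moreover have "GPair q (path_comp p b) \<in> carrier (gis G)"
        using q p ab by (simp add: GPair_carrier is_path_comp dom_path_comp)
      ultimately show ?thesis using nat_le_gisI[OF q(2,4)] q(5) by simp
    next
      case (2 p)
      then have p: "is_path G p" "ran_path G p = dom_path q" "a = path_comp p q"
        by (auto simp: is_left_factor_def)
      have "y \<cdot>\<^bsub>gis G\<^esub> GPair a b = GPair a b"
        using gis_prod_comp_right[OF p(1,2) q(3), of q b] ab p
        by (simp add: sprod_gis q dom_path_comp)
      then show ?thesis using nat_le_gisI[OF assms(1-3)] w by simp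
    qed
  qed
  ultimately show ?thesis
    by (intro up_closure_least[OF refl]) blast+
qed

text \<open>For t = (a, b) the coset condition says that (a, a) lies above (w, w), so
  \<open>a\<close> is a suffix of \<open>w\<close> and the previous computation applies. Conversely,
  \<open>x\<close> comes from t = (w, x), with an empty prefix.\<close>

lemma right_cosets_principal:
  assumes "is_path G w"
  shows "right_cosets (gis G) (up_closure (gis G) {GPair w w}) =
    (\<lambda>x. up_closure (gis G) {GPair w x}) ` {x. is_path G x \<and> dom_path x = dom_path w}"
    (is "right_cosets _ ?L = ?R")
proof
  show "right_cosets (gis G) ?L \<subseteq> ?R"
  proof
    fix C assume "C \<in> right_cosets (gis G) ?L"
    then obtain t where t: "t \<in> carrier (gis G)" "t \<cdot>\<^bsub>gis G\<^esub> sinv (gis G) t \<in> ?L"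
      and C: "C = up_closure (gis G) {x \<cdot>\<^bsub>gis G\<^esub> t | x. x \<in> ?L}"
      by (auto simp: right_cosets_def)
    from t(1) show "C \<in> ?R"
    proof (cases rule: gis_carrier_cases)
      case 1
      \<comment> \<open>Only pairs lie above (w, w), so zero cannot represent a coset.\<close>
      then have "GZero \<in> ?L" using t(2) by (simp add: sprod_gis)
      then show ?thesis using mem_principal_up_closure[OF assms] by blast
    next
      case (2 a b)
      then have "GPair a a \<in> ?L"
        using t(2) gis_prod_inverse[of b a a] by (simp add: sinv_gis sprod_gis)
      then obtain h where h: "is_path G h" "ran_path G h = dom_path a" "w = path_comp h a"
        unfolding mem_principal_up_closure[OF assms] by blast
      have "C = up_closure (gis G) {GPair w (path_comp h b)}"
        using C t(1) principal_coset[OF h(1,2) _ h(3)] 2(1) by simp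
      moreover have "is_path G (path_comp h b)" "dom_path (path_comp h b) = dom_path w"
        using h 2 by (simp_all add: is_path_comp dom_path_comp)
      ultimately show ?thesis by blast
    qed
  qed
  show "?R \<subseteq> right_cosets (gis G) ?L"
  proof
    fix C assume "C \<in> ?R"
    then obtain x where x: "is_path G x" "dom_path x = dom_path w"
      and C: "C = up_closure (gis G) {GPair w x}" by blast
    have t: "GPair w x \<in> carrier (gis G)" using x assms by (simp add: GPair_carrier)
    have "path_comp (dom_path w, []) x = x" using trivial_path(3)[OF x(1)] x(2) by simp
    then have "C = up_closure (gis G) {y \<cdot>\<^bsub>gis G\<^esub> GPair w x | y. y \<in> ?L}"
      using principal_coset[OF trivial_path(1,2)[OF assms] t trivial_path(3)[OF assms, symmetric]] C
      by simp
    moreover have "GPair w x \<cdot>\<^bsub>gis G\<^esub> sinv (gis G) (GPair w x) = GPair w w"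
      using x assms gis_prod_inverse[of x w w] by (simp add: sinv_gis sprod_gis)
    moreover have "GPair w w \<in> ?L"
      using nat_le_gis_refl assms by (simp add: up_closure_def GPair_carrier)
    ultimately show "C \<in> right_cosets (gis G) ?L"
      unfolding right_cosets_def using t by auto
  qed
qed

section \<open>The index as a number of walks\<close>

lemma paths_eq_walks:
  "{x. is_path G x \<and> dom_path x = v \<and> P (snd x)} = Pair v ` {p \<in> walks_from v. P p}"
  by (auto simp: is_path_def dom_path_def walks_from_def image_iff)

lemma coset_index_principal:
  assumes "is_path G w"
  shows "coset_index (gis G) (up_closure (gis G) {GPair w w}) = ecard (walks_from (dom_path w))"
proof -
  let ?P = "{x. is_path G x \<and> dom_path x = dom_path w}"
  have "inj_on (\<lambda>x. up_closure (gis G) {GPair w x}) ?P"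
  proof (rule inj_onI)
    fix x y assume xy: "x \<in> ?P" "y \<in> ?P"
      and eq: "up_closure (gis G) {GPair w x} = up_closure (gis G) {GPair w y}"
    have "GPair w y \<in> up_closure (gis G) {GPair w x}"
      unfolding eq using xy assms nat_le_gis_refl by (simp add: up_closure_def GPair_carrier)
    then show "x = y" using nat_le_gis_same_fst[of w x y] by (simp add: up_closure_def)
  qed
  moreover have "ecard ?P = ecard (walks_from (dom_path w))"
    using paths_eq_walks[of "dom_path w" "\<lambda>_. True"] by (simp add: ecard_image inj_on_def)
  ultimately show ?thesis
    by (simp add: coset_index_def right_cosets_principal[OF assms] ecard_image)
qed

lemma diverging_paths_eq:
  "diverging_paths G v w = ecard {p \<in> walks_from v. p = [] \<or> hd p \<notin> set (snd w)}"
  using paths_eq_walks[of v "\<lambda>p. p = [] \<or> hd p \<notin> set (snd w)"]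
  by (simp add: diverging_paths_def empty_path_def path_edges_def ecard_image inj_on_def)

text \<open>In a chain a minimal element is least, and a closed set with a least element is the
  up-set of that element.\<close>

lemma chain_eq_principal:
  assumes "proper_closed_chain (gis G) L" "minimal_element (gis G) L (GPair w w)"
  shows "is_path G w" "L = up_closure (gis G) {GPair w w}"
proof -
  have L: "L \<subseteq> carrier (gis G)" "up_closed (gis G) L" "idempotent_chain (gis G) L"
    using assms(1)
    by (auto simp: proper_closed_chain_def closed_inverse_subsemigroup_def up_closed_def)
  have w: "GPair w w \<in> L" using assms(2) by (simp add: minimal_element_def)
  then show "is_path G w" using L(1) by (auto simp: GPair_carrier)
  have "nat_le (gis G) (GPair w w) x" if "x \<in> L" for x
  proof -
    have "nat_le (gis G) x (GPair w w) \<or> nat_le (gis G) (GPair w w) x"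
      using L(3) w that by (simp add: idempotent_chain_def)
    moreover have "nat_le (gis G) x (GPair w w) \<longrightarrow> x = GPair w w"
      using assms(2) that by (simp add: minimal_element_def)
    ultimately show ?thesis using L(1) that nat_le_gis_refl by auto
  qed
  then show "L = up_closure (gis G) {GPair w w}"
    using L w by (auto simp: up_closure_def up_closed_def)
qed

section \<open>Cosets of an infinite chain\<close>

text \<open>Zero lies below everything, so a closed set containing it is the whole semigroup, which
  properness excludes.\<close>

lemma proper_closed_chain_elem:
  assumes "proper_closed_chain (gis G) L" "x \<in> L"
  obtains q where "is_path G q" "x = GPair q q"
proof -
  have L: "L \<subseteq> carrier (gis G)" "\<forall>a\<in>L. \<forall>s\<in>carrier (gis G). nat_le (gis G) a s \<longrightarrow> s \<in> L"
    "L \<noteq> carrier (gis G)" "x \<in> idempotents (gis G)"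
    using assms by (auto simp: proper_closed_chain_def closed_inverse_subsemigroup_def
        up_closed_def idempotent_chain_def)
  have "nat_le (gis G) GZero s" if "s \<in> carrier (gis G)" for s
    using that GZero_carrier nat_le_gis_iff by blast
  then have "x \<noteq> GZero" using L assms(2) by blast
  then show ?thesis using that L(4) unfolding idempotents_gis by blast
qed

lemma infinite_coset_index_chain:
  assumes "proper_closed_chain (gis G) L" "infinite L"
  shows "coset_index (gis G) L = \<infinity>"
proof -
  define Q where "Q = {q. GPair q q \<in> L}"
  \<comment> \<open>The second component is the empty path at d(q). For \<open>q\<close> in
    \<open>Q\<close>, the product of \<open>t q\<close> with its inverse is (q, q), which lies in
    \<open>L\<close>, and the lengths of the components of \<open>t q\<close> differ by exactly the
    length of \<open>q\<close>.\<close>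
  define t where "t q = GPair q (dom_path q, [])" for q :: "('a, 'b) path"
  define C where "C q = up_closure (gis G) {x \<cdot>\<^bsub>gis G\<^esub> t q | x. x \<in> L}" for q
  have path: "is_path G q" if "q \<in> Q" for q
    using proper_closed_chain_elem[OF assms(1)] that unfolding Q_def by blast
  \<comment> \<open>By totality of the chain, (q', q') lies below (q, q), which supplies the
    prefix.\<close>
  have comp: "\<exists>p. is_path G p \<and> ran_path G p = dom_path q \<and> q' = path_comp p q"
    if "q \<in> Q" "q' \<in> Q" "\<not> nat_le (gis G) (GPair q q) (GPair q' q')" for q q'
  proof -
    have "nat_le (gis G) (GPair q' q') (GPair q q)"
      using assms(1) that by (auto simp: proper_closed_chain_def idempotent_chain_def Q_def)
    then show ?thesis by (elim nat_le_gisE) blast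
  qed
  have "L = (\<lambda>q. GPair q q) ` Q"
    using proper_closed_chain_elem[OF assms(1)] unfolding Q_def by blast
  then have "infinite Q" using assms(2) by auto
  have t_carrier: "t q \<in> carrier (gis G)" if "q \<in> Q" for q
    unfolding t_def using path[OF that] trivial_path(1)
    by (simp add: GPair_carrier) (simp add: dom_path_def)
  have coset: "C q \<in> right_cosets (gis G) L" if "q \<in> Q" for q
  proof -
    have "sinv (gis G) (t q) = GPair (dom_path q, []) q"
      unfolding t_def using path[OF that] trivial_path(1)[OF path[OF that]]
      by (intro sinv_gis) (simp_all add: dom_path_def)
    then have "t q \<cdot>\<^bsub>gis G\<^esub> sinv (gis G) (t q) = GPair q q"
      unfolding t_def sprod_gis using trivial_path(1)[OF path[OF that]]
      by (simp only: gis_prod_inverse) (simp add: gis_prod_inverse dom_path_def del: gis_prod.simps)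
    then show ?thesis
      unfolding right_cosets_def C_def using that t_carrier[OF that] unfolding Q_def by auto
  qed
  have self: "t q \<in> C q" if "q \<in> Q" for q
  proof -
    have "GPair q q \<cdot>\<^bsub>gis G\<^esub> t q = t q"
      unfolding t_def sprod_gis using path[OF that]
      by (intro gis_prod_inverse) (simp_all add: dom_path_def)
    then show ?thesis
      unfolding C_def up_closure_def using that nat_le_gis_refl[OF t_carrier[OF that]]
        t_carrier[OF that] unfolding Q_def by force
  qed
  \<comment> \<open>Elements of \<open>L\<close> are diagonal, so multiplying \<open>t q\<close> by
    them yields a pair (hq, h). Passing to a larger pair then strips a common prefix. Neither
    affects the length difference.\<close>
  have length_diff: "length (snd a) = length (snd b) + length (snd q)"
    if q: "q \<in> Q" and ab: "GPair a b \<in> C q" for a b q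
  proof -
    obtain x where x: "x \<in> L" "nat_le (gis G) (x \<cdot>\<^bsub>gis G\<^esub> t q) (GPair a b)"
      using ab unfolding C_def up_closure_def by blast
    obtain q' where q': "q' \<in> Q" "x = GPair q' q'" "is_path G q'"
      using proper_closed_chain_elem[OF assms(1) x(1)] x(1) unfolding Q_def by blast
    have "\<exists>h. x \<cdot>\<^bsub>gis G\<^esub> t q = GPair (path_comp h q) (path_comp h (dom_path q, []))"
    proof (cases "nat_le (gis G) (GPair q q) (GPair q' q')")
      case True
      then obtain p where p: "is_path G p" "ran_path G p = dom_path q'" "q = path_comp p q'"
        by (elim nat_le_gisE) blast
      have "gis_prod G (GPair q' q') (GPair (path_comp p q') (dom_path q, []))
          = GPair (path_comp p q') (dom_path q, [])"
        using p by (intro gis_prod_comp_right q'(3)) (simp_all add: dom_path_def path_comp_def)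
      then have "x \<cdot>\<^bsub>gis G\<^esub> t q = t q"
        unfolding t_def q' sprod_gis p(3) .
      \<comment> \<open>Here \<open>x\<close> fixes \<open>t q\<close>; writing the result with an
        empty \<open>h\<close> gives both cases the same form.\<close>
      then have "x \<cdot>\<^bsub>gis G\<^esub> t q
          = GPair (path_comp (dom_path q, []) q) (path_comp (dom_path q, []) (dom_path q, []))"
        by (simp add: t_def path_comp_def dom_path_def)
      then show ?thesis ..
    next
      case False
      then obtain p where p: "is_path G p" "ran_path G p = dom_path q" "q' = path_comp p q"
        using comp[OF q q'(1)] by blast
      then have "x \<cdot>\<^bsub>gis G\<^esub> t q = GPair (path_comp p q) (path_comp p (dom_path q, []))"
        unfolding t_def q' sprod_gis by (simp only: gis_prod_comp_left)
      then show ?thesis ..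
    qed
    then obtain h where "nat_le (gis G) (GPair (path_comp h q) (path_comp h (dom_path q, [])))
        (GPair a b)" using x(2) by metis
    then obtain p where "path_comp h q = path_comp p a" "path_comp h (dom_path q, []) = path_comp p b"
      by (elim nat_le_gisE) blast
    then have "snd h @ snd q = snd p @ snd a" "snd h = snd p @ snd b"
      by (simp_all add: path_comp_def)
    from this[THEN arg_cong[of _ _ length]] show ?thesis by simp
  qed
  have "inj_on C Q"
  proof (rule inj_onI)
    fix q q' assume q: "q \<in> Q" "q' \<in> Q" and eq: "C q = C q'"
    \<comment> \<open>The pair \<open>t q\<close> lies in both cosets, so its length difference is
      the length of \<open>q\<close> and also that of \<open>q'\<close>.\<close>
    have len: "length (snd q) = length (snd q')"
      using length_diff[OF q(2), of q "(dom_path q, [])"] self[OF q(1)] eq by (simp add: t_def)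
    \<comment> \<open>Equal lengths make the prefix \<open>p\<close> empty; its end point then
      identifies the initial vertices as well.\<close>
    have eqI: "q = q'" if "\<exists>p. ran_path G p = dom_path q \<and> q' = path_comp p q"
      "length (snd q) = length (snd q')" for q q'
      using that by (auto simp: path_comp_def ran_path_def dom_path_def prod_eq_iff)
    show "q = q'"
    proof (cases "nat_le (gis G) (GPair q q) (GPair q' q')")
      case True
      then obtain p where "ran_path G p = dom_path q'" "q = path_comp p q'"
        by (elim nat_le_gisE) blast
      then show ?thesis using eqI[of q' q] len by metis
    next
      case False
      then show ?thesis using comp[OF q] eqI[of q q'] len by blast
    qed
  qed
  then have "infinite (C ` Q)" using \<open>infinite Q\<close> by (simp add: finite_image_iff)
  moreover have "C ` Q \<subseteq> right_cosets (gis G) L" using coset by blast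
  ultimately show ?thesis
    unfolding coset_index_def ecard_eq_infinity_iff using finite_subset by blast
qed

end

section \<open>The circuit criterion and the assembly of the three claims\<close>

lemma (in fin_digraph) infinite_walks_from_iff:
  assumes "is_path G w"
  shows "infinite (walks_from (dom_path w)) \<longleftrightarrow>
    (\<exists>c g. circuit G c \<and> \<not> empty_path c \<and>
       is_path G g \<and> dom_path g \<in> path_verts G w \<and> ran_path G g \<in> path_verts G c \<and>
       path_edges g \<inter> (path_edges c \<union> path_edges w) = {})" (is "_ \<longleftrightarrow> ?R")
proof
  have w: "awalk (dom_path w) (snd w) (ran_path G w)"
    using assms by (simp add: is_path_iff dom_path_def)
  {
    assume "infinite (walks_from (dom_path w))"
    then obtain p v c where p: "awalk (dom_path w) p v" and c: "awalk v c v" "c \<noteq> []"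
      by (rule infinite_walks_fromE)
    \<comment> \<open>The walk \<open>p\<close> starts on \<open>w\<close> and ends on
      \<open>c\<close>, so a shortest walk between the two exists. Its start \<open>x\<close> serves
      as v_0 and may differ from d(w).\<close>
    from hd_in_awalk_verts(1)[OF w] hd_in_awalk_verts(1)[OF c(1)]
    obtain x g y where g: "awalk x g y" "x \<in> set (awalk_verts (dom_path w) (snd w))"
      "y \<in> set (awalk_verts v c)" "set g \<inter> (set c \<union> set (snd w)) = {}"
      using shortest_awalk_between[OF p _ _ w] by metis
    have "circuit G (v, c)" "\<not> empty_path (v, c)"
      using c by (auto simp: circuit_def is_path_def dom_path_def ran_path_def empty_path_def)
    moreover have "is_path G (x, g)" "dom_path (x, g) \<in> path_verts G w"
      "ran_path G (x, g) \<in> path_verts G (v, c)"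
      "path_edges (x, g) \<inter> (path_edges (v, c) \<union> path_edges w) = {}"
      using g by (auto simp: is_path_def dom_path_def ran_path_def path_verts_def path_edges_def)
    ultimately show ?R by blast
  next
    assume ?R
    then obtain c g where c: "awalk (dom_path c) (snd c) (dom_path c)" "snd c \<noteq> []"
      and g: "awalk (dom_path g) (snd g) (ran_path G g)"
      and verts: "dom_path g \<in> set (awalk_verts (dom_path w) (snd w))"
        "ran_path G g \<in> set (awalk_verts (dom_path c) (snd c))"
      by (auto simp: circuit_def is_path_iff empty_path_def path_verts_def dom_path_def)
    \<comment> \<open>Follow \<open>w\<close> to the start of \<open>g\<close>, then
      \<open>g\<close>, then circle along \<open>c\<close>, rotated so that it starts where
      \<open>g\<close> ends.\<close>
    from awalk_decomp[OF w verts(1)] obtain h where h: "awalk (dom_path w) h (dom_path g)" by blast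
    from c verts(2) obtain c' where "awalk (ran_path G g) c' (ran_path G g)" "c' \<noteq> []"
      by (rule awalk_rotate)
    then show "infinite (walks_from (dom_path w))"
      using infinite_walks_from[OF awalk_appendI[OF h g]] by blast
  }
qed

lemma (in fin_digraph) coset_index_finite_chain_eq_infinity_iff:
  assumes "proper_closed_chain (gis G) L" "minimal_element (gis G) L (GPair w w)"
  shows "coset_index (gis G) L = \<infinity> \<longleftrightarrow>
    (\<exists>c g. circuit G c \<and> \<not> empty_path c \<and>
       is_path G g \<and> dom_path g \<in> path_verts G w \<and> ran_path G g \<in> path_verts G c \<and>
       path_edges g \<inter> (path_edges c \<union> path_edges w) = {})"
proof -
  have w: "is_path G w" and L: "L = up_closure (gis G) {GPair w w}"
    using chain_eq_principal[OF assms] .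
  have "coset_index (gis G) L = \<infinity> \<longleftrightarrow> infinite (walks_from (dom_path w))"
    unfolding L coset_index_principal[OF w] ecard_eq_infinity_iff ..
  then show ?thesis unfolding infinite_walks_from_iff[OF w] .
qed

text \<open>Finite index bounds the walks from d(w), which forces the vertices of \<open>w\<close>
  to be distinct. The count along \<open>w\<close> can therefore be indexed by its vertex
  set.\<close>

lemma (in wf_digraph) finite_coset_index_principal:
  assumes w: "is_path G w" and fin: "coset_index (gis G) (up_closure (gis G) {GPair w w}) \<noteq> \<infinity>"
  shows "coset_index (gis G) (up_closure (gis G) {GPair w w}) =
    (\<Sum>v\<in>path_verts G w. diverging_paths G v w)"
proof -
  have index: "coset_index (gis G) (up_closure (gis G) {GPair w w}) = ecard (walks_from (fst w))"
    using coset_index_principal[OF w] by (simp add: dom_path_def)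
  have walk: "awalk (fst w) (snd w) (ran_path G w)" using w by (simp add: is_path_iff)
  moreover have "finite (walks_from (fst w))" using fin index by (simp add: ecard_eq_infinity_iff)
  ultimately have "distinct (awalk_verts (fst w) (snd w))"
    using distinct_awalk_verts_if_finite_walks by blast
  then show ?thesis
    unfolding index diverging_paths_eq path_verts_def using ecard_walks_from[OF walk] by simp
qed

theorem theorem4p1:
  fixes G :: "('a, 'b) pre_digraph"
  assumes "fin_digraph G"
  shows
    "(\<forall>L w. finite_chain_type (gis G) L \<longrightarrow> minimal_element (gis G) L (GPair w w) \<longrightarrow>
        (coset_index (gis G) L = \<infinity> \<longleftrightarrow>
          (\<exists>c g. circuit G c \<and> \<not> empty_path c \<and>
             is_path G g \<and> dom_path g \<in> path_verts G w \<and> ran_path G g \<in> path_verts G c \<and>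
             path_edges g \<inter> (path_edges c \<union> path_edges w) = {}))) \<and>
     (\<forall>L w. is_path G w \<longrightarrow> L = up_closure (gis G) {GPair w w} \<longrightarrow>
        coset_index (gis G) L \<noteq> \<infinity> \<longrightarrow>
        coset_index (gis G) L = (\<Sum>v\<in>path_verts G w. diverging_paths G v w)) \<and>
     (\<forall>L. infinite_chain_type (gis G) L \<longrightarrow> coset_index (gis G) L = \<infinity>)"
proof (intro conjI allI impI)
  interpret fin_digraph G by fact
  fix L w
  show "coset_index (gis G) L = \<infinity> \<longleftrightarrow>
      (\<exists>c g. circuit G c \<and> \<not> empty_path c \<and>
         is_path G g \<and> dom_path g \<in> path_verts G w \<and> ran_path G g \<in> path_verts G c \<and>
         path_edges g \<inter> (path_edges c \<union> path_edges w) = {})"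
    if "finite_chain_type (gis G) L" "minimal_element (gis G) L (GPair w w)"
    using that(1) coset_index_finite_chain_eq_infinity_iff[OF _ that(2)]
    unfolding finite_chain_type_def by satx
  show "coset_index (gis G) L = (\<Sum>v\<in>path_verts G w. diverging_paths G v w)"
    if "is_path G w" "L = up_closure (gis G) {GPair w w}" "coset_index (gis G) L \<noteq> \<infinity>"
    using finite_coset_index_principal[OF that(1)] that(3) unfolding that(2) by satx
  show "coset_index (gis G) L = \<infinity>" if "infinite_chain_type (gis G) L"
    using that infinite_coset_index_chain[of L] unfolding infinite_chain_type_def by satx
qed

end
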